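(* Let $\Omega$ be either an open connected subset of $\mathbb{R}^2$ with Lipschitz boundary or the torus $\mathbb{T}^2$ with side lengths $L_x,L_y$. Assume $\eta\in L^\infty(\Omega)$, $\nabla h\in L^\infty(\Omega)$ and $\eta_{\min}>0$. Let $B[\cdot,\cdot]$ be the bilinear form of $\mathcal{G}_{\eta,h}$, and let $A[\cdot,\cdot]$ be the bilinear form of $\mathcal{A}=\sigma^\star \boldsymbol{I}-\alpha^\star\nabla(\nabla\cdot)$ with the following coefficients: (i) if $|\nabla h|_{\max}=0$, $$\sigma^\star=\eta_{\max},\qquad \alpha^\star=\tfrac13\eta_{\max}^3,\qquad \kappa_{\rm ub}=\left(\frac{\eta_{\max}}{\eta_{\min}}\right)^3;$$ (ii) if $|\nabla h|_{\max}\neq 0$, $$\sigma^\star=\max_{\boldsymbol{x}\in\Omega}\left(\eta(\boldsymbol{x})+\tfrac16(4+\sqrt{13})\,\eta(\boldsymbol{x})|\nabla h(\boldsymbol{x})|^2\right),\qquad \alpha^\star=\tfrac16(4+\sqrt{13})\,\eta_{\max}^3,$$ $$\kappa_{\rm ub}=\max\left\{\frac{\sigma^\star}{\eta_{\min}},\ \left(\frac{4+\sqrt{13}}{4-\sqrt{13}}\right)\left(\frac{\eta_{\max}}{\eta_{\min}}\right)^3\right\}.$$ Then the condition number $\kappa_{\mathcal{A}}(\mathcal{G}_{\eta,h})$ of $\mathcal{A}^{-1}\mathcal{G}_{\eta,h}$ satisfies $$\kappa_{\mathcal{A}}(\mathcal{G}_{\eta,h})\le \kappa_{\rm ub}.$$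 Moreover, the generalized eigenvalues $\lambda$ of $\mathcal{G}_{\eta,h}\boldsymbol{u}=\lambda\mathcal{A}\boldsymbol{u}$ are real and satisfy $$\kappa_{\rm ub}^{-1}\le\lambda\le 1.$$
   Context: Here $\eta,h:\Omega\to\mathbb{R}$ are real-valued functions of $\boldsymbol{x}\in\Omega$. Notation: $|\nabla h|_{\max}=\max_{\boldsymbol{x}\in\Omega}|\nabla h(\boldsymbol{x})|$, $\eta_{\min}=\min_{\boldsymbol{x}\in\Omega}\eta(\boldsymbol{x})$, $\eta_{\max}=\max_{\boldsymbol{x}\in\Omega}\eta(\boldsymbol{x})$. All maxima and minima over $\boldsymbol{x}\in\Omega$ are understood as essential suprema and essential infima. The function space is $$H_{\rm div}(\Omega)=\{\boldsymbol{u}\in[L^2(\Omega)]^2:\ \nabla\cdot\boldsymbol{u}\in L^2(\Omega),\ \boldsymbol{n}\cdot\boldsymbol{u}=0\text{ on }\partial\Omega\},$$ where $\boldsymbol{n}$ is the outward unit normal and the normal trace condition is understood in $H^{-1/2}(\partial\Omega)$; when $\Omega=\mathbb{T}^2$ the boundary condition is replaced by periodicity. The norm is $\|\boldsymbol{u}\|_{\rm div}^2=\int_\Omega[|\boldsymbol{u}|^2+(\nabla\cdot\boldsymbol{u})^2]\,d\boldsymbol{x}$. Functions are real-valued. The operator $\mathcal{G}_{\eta,h}$ is, in strong form, $$\mathcal{G}_{\eta,h}\boldsymbol{u}=\eta\boldsymbol{u}-\nabla(\tfrac13\eta^3\,\nabla\cdot\boldsymbol{u})-\nabla(\tfrac12\eta^2\,\nabla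 h\cdot\boldsymbol{u})+\tfrac12\eta^2\nabla h\,(\nabla\cdot\boldsymbol{u})+\eta\nabla h\,(\nabla h\cdot\boldsymbol{u}).$$ The operators are understood through the following symmetric bilinear forms on $H_{\rm div}(\Omega)\times H_{\rm div}(\Omega)$: $$A[\boldsymbol{u},\boldsymbol{v}]=\int_\Omega\left[\sigma^\star\,\boldsymbol{u}\cdot\boldsymbol{v}+\alpha^\star(\nabla\cdot\boldsymbol{v})(\nabla\cdot\boldsymbol{u})\right]d\boldsymbol{x},$$ $$B[\boldsymbol{u},\boldsymbol{v}]=\int_\Omega\Big[\eta\,\boldsymbol{u}\cdot\boldsymbol{v}+\tfrac13\eta^3(\nabla\cdot\boldsymbol{u})(\nabla\cdot\boldsymbol{v})+\tfrac12\eta^2(\nabla\cdot\boldsymbol{v})(\nabla h\cdot\boldsymbol{u})+\tfrac12\eta^2(\nabla\cdot\boldsymbol{u})(\nabla h\cdot\boldsymbol{v})+\eta(\nabla h\cdot\boldsymbol{u})(\nabla h\cdot\boldsymbol{v})\Big]d\boldsymbol{x}.$$ The condition number is $\kappa_{\mathcal{A}}(\mathcal{G}_{\eta,h})=\mu_{\max}/\mu_{\min}$, where $$\mu_{\min}=\inf_{0\ne\boldsymbol{u}\in H_{\rm div}(\Omega)}\frac{B[\boldsymbol{u},\boldsymbol{u}]}{A[\boldsymbol{u},\boldsymbol{u}]},\qquad \mu_{\max}=\sup_{0\ne\boldsymbol{u}\in H_{\rm div}(\Omega)}\frac{B[\boldsymbol{u},\boldsymbol{u}]}{A[\boldsymbol{u},\boldsymbol{u}]}.$$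 The generalized eigenvalue problem $\mathcal{G}_{\eta,h}\boldsymbol{u}=\lambda\mathcal{A}\boldsymbol{u}$ means: find $\lambda$ and $0\neq\boldsymbol{u}\in H_{\rm div}(\Omega)$ with $\lambda A[\boldsymbol{u},\boldsymbol{v}]=B[\boldsymbol{u},\boldsymbol{v}]$ for all $\boldsymbol{v}\in H_{\rm div}(\Omega)$. *)

theory Defs
  imports "HOL-Analysis.Analysis" "HOL-Probability.Essential_Supremum"
begin

section \<open>Domains\<close>

text \<open>
  A domain is either a subset of the plane or the flat torus with side lengths \<open>Lx\<close>, \<open>Ly\<close>.
  Functions on the torus are functions on the plane that are periodic in both coordinates;
  they are integrated over one period cell.
\<close>

datatype flow_domain = Planar "(real^2) set" | Torus real real

text \<open>Near each of its boundary points the set is, in suitable Cartesian coordinates, the part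
  above the graph of a Lipschitz function.\<close>

definition lipschitz_boundary :: "(real^2) set \<Rightarrow> bool" where
  "lipschitz_boundary S \<longleftrightarrow>
     (\<forall>p\<in>frontier S. \<exists>r>0. \<exists>(T :: real^2 \<Rightarrow> real^2) \<gamma> C. orthogonal_transformation T \<and> C-lipschitz_on UNIV \<gamma> \<and>
        (\<forall>x\<in>ball p r. x \<in> S \<longleftrightarrow> \<gamma> (T x $ 1) < T x $ 2))"

fun admissible :: "flow_domain \<Rightarrow> bool" where
  "admissible (Planar S) \<longleftrightarrow> open S \<and> connected S \<and> S \<noteq> {} \<and> lipschitz_boundary S"
| "admissible (Torus Lx Ly) \<longleftrightarrow> Lx > 0 \<and> Ly > 0"

fun dmeasure :: "flow_domain \<Rightarrow> (real^2) measure" where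
  "dmeasure (Planar S) = lebesgue_on S"
| "dmeasure (Torus Lx Ly) = lebesgue_on {x. 0 \<le> x $ 1 \<and> x $ 1 < Lx \<and> 0 \<le> x $ 2 \<and> x $ 2 < Ly}"

text \<open>A function on a planar set is a function on the plane whose values outside the set are
  ignored, so only the torus imposes a condition.\<close>

fun fun_on :: "flow_domain \<Rightarrow> (real^2 \<Rightarrow> 'a) \<Rightarrow> bool" where
  "fun_on (Planar S) f \<longleftrightarrow> True"
| "fun_on (Torus Lx Ly) f \<longleftrightarrow> (\<forall>x. f (x + axis 1 Lx) = f x \<and> f (x + axis 2 Ly) = f x)"


section \<open>Function spaces and weak derivatives\<close>

definition L2 :: "flow_domain \<Rightarrow> (real^2 \<Rightarrow> 'a::euclidean_space) \<Rightarrow> bool" where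
  "L2 D f \<longleftrightarrow> fun_on D f \<and> f \<in> borel_measurable (dmeasure D) \<and>
     integrable (dmeasure D) (\<lambda>x. (norm (f x))\<^sup>2)"

definition ess_max :: "flow_domain \<Rightarrow> (real^2 \<Rightarrow> real) \<Rightarrow> real" where
  "ess_max D f = real_of_ereal (esssup (dmeasure D) (\<lambda>x. ereal (f x)))"

definition ess_min :: "flow_domain \<Rightarrow> (real^2 \<Rightarrow> real) \<Rightarrow> real" where
  "ess_min D f = - ess_max D (\<lambda>x. - f x)"

definition Linf :: "flow_domain \<Rightarrow> (real^2 \<Rightarrow> 'a::euclidean_space) \<Rightarrow> bool" where
  "Linf D f \<longleftrightarrow> fun_on D f \<and> f \<in> borel_measurable (dmeasure D) \<and>
     esssup (dmeasure D) (\<lambda>x. ereal (norm (f x))) < \<infinity>"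

fun loc_integrable :: "flow_domain \<Rightarrow> (real^2 \<Rightarrow> 'a::euclidean_space) \<Rightarrow> bool" where
  "loc_integrable (Planar S) f \<longleftrightarrow> (\<forall>K. compact K \<and> K \<subseteq> S \<longrightarrow> set_integrable lebesgue K f)"
| "loc_integrable (Torus Lx Ly) f \<longleftrightarrow> integrable (dmeasure (Torus Lx Ly)) f"

primrec C_k :: "nat \<Rightarrow> (real^2 \<Rightarrow> real) \<Rightarrow> bool" where
  "C_k 0 f \<longleftrightarrow> continuous_on UNIV f"
| "C_k (Suc k) f \<longleftrightarrow> (\<exists>g. (\<forall>x. GDERIV f x :> g x) \<and> (\<forall>i. C_k k (\<lambda>x. g x $ i)))"

fun test_fun :: "flow_domain \<Rightarrow> (real^2 \<Rightarrow> real) \<Rightarrow> bool" where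
  "test_fun (Planar S) \<phi> \<longleftrightarrow> (\<forall>k. C_k k \<phi>) \<and>
     compact (closure {x. \<phi> x \<noteq> 0}) \<and> closure {x. \<phi> x \<noteq> 0} \<subseteq> S"
| "test_fun (Torus Lx Ly) \<phi> \<longleftrightarrow> (\<forall>k. C_k k \<phi>) \<and> fun_on (Torus Lx Ly) \<phi>"

definition is_weak_grad :: "flow_domain \<Rightarrow> (real^2 \<Rightarrow> real) \<Rightarrow> (real^2 \<Rightarrow> real^2) \<Rightarrow> bool" where
  "is_weak_grad D f g \<longleftrightarrow> fun_on D f \<and> fun_on D g \<and> loc_integrable D f \<and> loc_integrable D g \<and>
     (\<forall>\<phi> d\<phi>. test_fun D \<phi> \<and> (\<forall>x. GDERIV \<phi> x :> d\<phi> x) \<longrightarrow>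
        (LINT x|dmeasure D. f x *\<^sub>R d\<phi> x) = - (LINT x|dmeasure D. \<phi> x *\<^sub>R g x))"

definition is_weak_div :: "flow_domain \<Rightarrow> (real^2 \<Rightarrow> real^2) \<Rightarrow> (real^2 \<Rightarrow> real) \<Rightarrow> bool" where
  "is_weak_div D u d \<longleftrightarrow> fun_on D u \<and> fun_on D d \<and> loc_integrable D u \<and> loc_integrable D d \<and>
     (\<forall>\<phi> d\<phi>. test_fun D \<phi> \<and> (\<forall>x. GDERIV \<phi> x :> d\<phi> x) \<longrightarrow>
        (LINT x|dmeasure D. u x \<bullet> d\<phi> x) = - (LINT x|dmeasure D. d x * \<phi> x))"

text \<open>Weak divergences are unique up to null sets; \<open>wdiv\<close> picks a representative.\<close>

definition wdiv :: "flow_domain \<Rightarrow> (real^2 \<Rightarrow> real^2) \<Rightarrow> real^2 \<Rightarrow> real" where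
  "wdiv D u = (SOME d. is_weak_div D u d)"

text \<open>
  The normal trace of a field \<open>u\<close> is the element of \<open>H\<^sup>-\<^sup>1\<^sup>/\<^sup>2\<close> of the boundary that is defined by
  Green's formula: on the trace of an \<open>H\<^sup>1\<close> function \<open>\<phi>\<close> with gradient \<open>g\<close> it takes the value
  \<open>\<integral> (u \<bullet> g + (div u) \<phi>)\<close>. The traces of \<open>H\<^sup>1\<close> functions make up all of \<open>H\<^sup>1\<^sup>/\<^sup>2\<close>, so the normal
  trace vanishes iff all these values do.
\<close>

definition normal_trace ::
    "flow_domain \<Rightarrow> (real^2 \<Rightarrow> real^2) \<Rightarrow> (real^2 \<Rightarrow> real) \<Rightarrow> (real^2 \<Rightarrow> real^2) \<Rightarrow> real" where
  "normal_trace D u \<phi> g = (LINT x|dmeasure D. u x \<bullet> g x + wdiv D u x * \<phi> x)"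

fun boundary_condition :: "flow_domain \<Rightarrow> (real^2 \<Rightarrow> real^2) \<Rightarrow> bool" where
  "boundary_condition (Planar S) u \<longleftrightarrow>
     (\<forall>\<phi> g. L2 (Planar S) \<phi> \<and> is_weak_grad (Planar S) \<phi> g \<and> L2 (Planar S) g \<longrightarrow>
        normal_trace (Planar S) u \<phi> g = 0)"
| "boundary_condition (Torus Lx Ly) u \<longleftrightarrow> fun_on (Torus Lx Ly) u"

definition Hdiv :: "flow_domain \<Rightarrow> (real^2 \<Rightarrow> real^2) set" where
  "Hdiv D = {u. L2 D u \<and> (\<exists>d. is_weak_div D u d) \<and> L2 D (wdiv D u) \<and> boundary_condition D u}"

text \<open>Elements of \<open>Hdiv\<close> are functions, not classes, so being nonzero is meant up to null sets.\<close>

definition Hdiv_nonzero :: "flow_domain \<Rightarrow> (real^2 \<Rightarrow> real^2) set" where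
  "Hdiv_nonzero D = {u \<in> Hdiv D. \<not> (AE x in dmeasure D. u x = 0)}"


section \<open>Bilinear forms, condition number and generalized eigenvalues\<close>

definition formA ::
    "flow_domain \<Rightarrow> real \<Rightarrow> real \<Rightarrow> (real^2 \<Rightarrow> real^2) \<Rightarrow> (real^2 \<Rightarrow> real^2) \<Rightarrow> real" where
  "formA D \<sigma> \<alpha> u v = (LINT x|dmeasure D. \<sigma> * (u x \<bullet> v x) + \<alpha> * wdiv D v x * wdiv D u x)"

text \<open>The argument \<open>gh\<close> is the gradient of \<open>h\<close>; the form depends on \<open>h\<close> only through it.\<close>

definition formB ::
    "flow_domain \<Rightarrow> (real^2 \<Rightarrow> real) \<Rightarrow> (real^2 \<Rightarrow> real^2) \<Rightarrow>
     (real^2 \<Rightarrow> real^2) \<Rightarrow> (real^2 \<Rightarrow> real^2) \<Rightarrow> real" where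
  "formB D \<eta> gh u v = (LINT x|dmeasure D.
       \<eta> x * (u x \<bullet> v x)
     + 1/3 * \<eta> x ^ 3 * wdiv D u x * wdiv D v x
     + 1/2 * (\<eta> x)\<^sup>2 * wdiv D v x * (gh x \<bullet> u x)
     + 1/2 * (\<eta> x)\<^sup>2 * wdiv D u x * (gh x \<bullet> v x)
     + \<eta> x * (gh x \<bullet> u x) * (gh x \<bullet> v x))"

text \<open>For bounded coefficients with \<open>\<eta>\<close> essentially bounded below by a positive constant and
  \<open>\<sigma>, \<alpha> > 0\<close>, the Rayleigh quotients are bounded and bounded away from \<open>0\<close>, so the real infimum
  and supremum and their quotient are meaningful.\<close>

definition mu_min ::
    "flow_domain \<Rightarrow> real \<Rightarrow> real \<Rightarrow> (real^2 \<Rightarrow> real) \<Rightarrow> (real^2 \<Rightarrow> real^2) \<Rightarrow> real" where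
  "mu_min D \<sigma> \<alpha> \<eta> gh = (INF u\<in>Hdiv_nonzero D. formB D \<eta> gh u u / formA D \<sigma> \<alpha> u u)"

definition mu_max ::
    "flow_domain \<Rightarrow> real \<Rightarrow> real \<Rightarrow> (real^2 \<Rightarrow> real) \<Rightarrow> (real^2 \<Rightarrow> real^2) \<Rightarrow> real" where
  "mu_max D \<sigma> \<alpha> \<eta> gh = (SUP u\<in>Hdiv_nonzero D. formB D \<eta> gh u u / formA D \<sigma> \<alpha> u u)"

definition cond_number ::
    "flow_domain \<Rightarrow> real \<Rightarrow> real \<Rightarrow> (real^2 \<Rightarrow> real) \<Rightarrow> (real^2 \<Rightarrow> real^2) \<Rightarrow> real" where
  "cond_number D \<sigma> \<alpha> \<eta> gh = mu_max D \<sigma> \<alpha> \<eta> gh / mu_min D \<sigma> \<alpha> \<eta> gh"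

definition gen_eigenvalue ::
    "flow_domain \<Rightarrow> real \<Rightarrow> real \<Rightarrow> (real^2 \<Rightarrow> real) \<Rightarrow> (real^2 \<Rightarrow> real^2) \<Rightarrow> complex \<Rightarrow> bool" where
  "gen_eigenvalue D \<sigma> \<alpha> \<eta> gh \<nu> \<longleftrightarrow>
     (\<exists>u\<in>Hdiv_nonzero D. \<forall>v\<in>Hdiv D.
        \<nu> * complex_of_real (formA D \<sigma> \<alpha> u v) = complex_of_real (formB D \<eta> gh u v))"

end

theory Submission imports Defs begin

text \<open>
  The bounds come from a pointwise comparison of the two integrands on the diagonal. Write
  \<open>d\<close> for the divergence of \<open>u\<close> and \<open>w = gh \<bullet> u\<close>. The integrand of \<open>B[u,u]\<close> is
  \<open>\<eta> |u|\<^sup>2 + \<eta> q(\<eta> d, w)\<close> with the quadratic form \<open>q(s,t) = s\<^sup>2/3 + s t + t\<^sup>2\<close>. The eigenvalues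
  of \<open>q\<close> are \<open>(4 \<plusminus> \<surd>13)/6\<close>, both positive, so \<open>q(s,t)\<close> lies between these multiples of
  \<open>s\<^sup>2 + t\<^sup>2\<close> (\<open>shallow_water_form_upper\<close>, \<open>shallow_water_form_lower\<close>). From above, \<open>w\<^sup>2\<close> is
  absorbed into \<open>|u|\<^sup>2\<close> by Cauchy-Schwarz, which produces exactly \<open>\<sigma>\<close> and \<open>\<alpha>\<close>; from below,
  \<open>w\<^sup>2\<close> is dropped. If \<open>gh\<close> vanishes, \<open>w = 0\<close> and \<open>q(\<eta> d, 0) = \<eta>\<^sup>2 d\<^sup>2/3\<close> needs no
  eigenvalue, whence the better constants.

  Thus the integrand of \<open>B[u,u]\<close> lies almost everywhere between \<open>1/\<kappa>\<close> times and once the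
  integrand of \<open>A[u,u]\<close>. Integration turns this into \<open>A[u,u]/\<kappa> \<le> B[u,u] \<le> A[u,u]\<close>
  with \<open>A[u,u] > 0\<close> (\<open>form_bounds\<close>), so all Rayleigh quotients lie in \<open>[1/\<kappa>, 1]\<close>. This bounds
  the condition number. A generalized eigenvalue is the Rayleigh quotient of its
  eigenfunction, as testing the eigenvalue equation with \<open>v = u\<close> shows; hence it is real and lies
  in the same interval.
\<close>

section \<open>Essential bounds\<close>

text \<open>The real value \<open>ess_max\<close> of an infinite essential supremum is \<open>0\<close>, so finiteness from above is
  essential here. The value \<open>-\<infinity>\<close> is harmless: it occurs only if the measure is zero.\<close>

lemma AE_le_ess_max:
  assumes "esssup (dmeasure D) (\<lambda>x. ereal (f x)) < \<infinity>"
  shows "AE x in dmeasure D. f x \<le> ess_max D f"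
proof (cases "esssup (dmeasure D) (\<lambda>x. ereal (f x))")
  case (real r)
  then show ?thesis
    using esssup_AE[of "\<lambda>x. ereal (f x)" "dmeasure D"] by (simp add: ess_max_def)
next
  case PInf
  then show ?thesis using assms by simp
next
  case MInf
  then have "AE x in dmeasure D. False"
    using esssup_AE[of "\<lambda>x. ereal (f x)" "dmeasure D"] by simp
  then show ?thesis
    by eventually_elim simp
qed

lemma AE_le_ess_max_if_AE_bounded:
  assumes "f \<in> borel_measurable (dmeasure D)" and "AE x in dmeasure D. f x \<le> C"
  shows "AE x in dmeasure D. f x \<le> ess_max D f"
proof (rule AE_le_ess_max)
  have "esssup (dmeasure D) (\<lambda>x. ereal (f x)) \<le> ereal C"
    using assms by (intro esssup_I) auto
  then show "esssup (dmeasure D) (\<lambda>x. ereal (f x)) < \<infinity>"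
    by (rule le_less_trans) simp
qed

lemma AE_norm_le_ess_max:
  assumes "Linf D f"
  shows "AE x in dmeasure D. norm (f x) \<le> ess_max D (\<lambda>x. norm (f x))"
  using assms by (intro AE_le_ess_max) (simp add: Linf_def)

text \<open>A positive \<open>ess_min\<close> cannot be the default value \<open>0\<close> that stands for an infinite essential
  infimum, so it is a genuine essential lower bound.\<close>

lemma AE_ess_min_le:
  assumes "ess_min D f > 0"
  shows "AE x in dmeasure D. ess_min D f \<le> f x"
proof -
  have "esssup (dmeasure D) (\<lambda>x. ereal (- f x)) < \<infinity>"
    using assms by (cases "esssup (dmeasure D) (\<lambda>x. ereal (- f x))")
      (simp_all add: ess_min_def ess_max_def)
  from AE_le_ess_max[OF this] show ?thesis
    by eventually_elim (simp add: ess_min_def)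
qed

text \<open>On a zero measure the essential infimum is \<open>\<infinity>\<close>, whose real value is \<open>0\<close>. So a positive
  \<open>ess_min\<close> shows that the domain is not null, and constants can be compared almost everywhere.\<close>

lemma not_AE_False_if_ess_min_pos:
  assumes "ess_min D f > 0"
  shows "\<not> (AE x in dmeasure D. False)"
proof
  assume null: "AE x in dmeasure D. False"
  have "(\<lambda>x. ereal (- f x)) \<in> borel_measurable (dmeasure D)"
  proof (rule ccontr)
    assume "\<not> ?thesis"
    then show False
      using assms by (simp add: ess_min_def ess_max_def esssup_def top_ereal_def)
  qed
  then have "esssup (dmeasure D) (\<lambda>x. ereal (- f x)) \<le> -\<infinity>"
    using null by (intro esssup_I) auto
  then show False
    using assms by (simp add: ess_min_def ess_max_def)
qed


section \<open>Pointwise bounds\<close>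

text \<open>
  The two differences below are rank-one forms, since the matrix of \<open>q(s,t) = s\<^sup>2/3 + s t + t\<^sup>2\<close>
  shifted by one of its eigenvalues is singular. The proofs complete that square.
\<close>

lemma shallow_water_form_upper:
  fixes s t :: real
  shows "1/3 * s\<^sup>2 + s * t + t\<^sup>2 \<le> 1/6 * (4 + sqrt 13) * (s\<^sup>2 + t\<^sup>2)"
proof -
  define r where "r = sqrt (13::real)"
  have r: "r * r = 13" "r > 0" by (simp_all add: r_def)
  have "0 \<le> (r + 2) / 6 * (s - (r - 2) / 3 * t)\<^sup>2"
    using r by simp
  also have "\<dots> = (r + 2) / 6 * s\<^sup>2 - (r * r - 4) / 9 * s * t + (r * r - 4) * (r - 2) / 54 * t\<^sup>2"
    by (simp add: field_simps power2_eq_square)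
  also have "\<dots> = 1/6 * (4 + r) * (s\<^sup>2 + t\<^sup>2) - (1/3 * s\<^sup>2 + s * t + t\<^sup>2)"
    unfolding r by (simp add: field_simps)
  finally show ?thesis by (simp add: r_def)
qed

lemma shallow_water_form_lower:
  fixes s t :: real
  shows "1/6 * (4 - sqrt 13) * (s\<^sup>2 + t\<^sup>2) \<le> 1/3 * s\<^sup>2 + s * t + t\<^sup>2"
proof -
  define r where "r = sqrt (13::real)"
  have r: "r * r = 13" "r > 0" by (simp_all add: r_def)
  have "0 \<le> (r + 2) / 6 * (t + (r - 2) / 3 * s)\<^sup>2"
    using r by simp
  also have "\<dots> = (r + 2) / 6 * t\<^sup>2 + (r * r - 4) / 9 * s * t + (r * r - 4) * (r - 2) / 54 * s\<^sup>2"
    by (simp add: field_simps power2_eq_square)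
  also have "\<dots> = 1/3 * s\<^sup>2 + s * t + t\<^sup>2 - 1/6 * (4 - r) * (s\<^sup>2 + t\<^sup>2)"
    unfolding r by (simp add: field_simps)
  finally show ?thesis by (simp add: r_def)
qed

lemma sqrt_13_less_4: "sqrt 13 < 4"
  by (rule real_less_lsqrt) simp_all

text \<open>The integrand of \<open>B[u,u]\<close> at one point, as a function of the values of \<open>\<eta>\<close>, \<open>gh\<close>, \<open>u\<close> and
  the divergence of \<open>u\<close>.\<close>

definition densB :: "real \<Rightarrow> 'a::real_inner \<Rightarrow> 'a \<Rightarrow> real \<Rightarrow> real" where
  "densB e g u d = e * (u \<bullet> u) + 1/3 * e ^ 3 * d\<^sup>2 + e\<^sup>2 * d * (g \<bullet> u) + e * (g \<bullet> u)\<^sup>2"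

lemma densB_eq:
  "densB e g u d = e * (u \<bullet> u) + e * (1/3 * (e * d)\<^sup>2 + (e * d) * (g \<bullet> u) + (g \<bullet> u)\<^sup>2)"
  by (simp add: densB_def field_simps power2_eq_square power3_eq_cube)

lemma densB_upper:
  assumes "0 < e" "e \<le> M" and \<sigma>: "e + 1/6 * (4 + sqrt 13) * e * (norm g)\<^sup>2 \<le> \<sigma>"
  shows "densB e g u d \<le> \<sigma> * (u \<bullet> u) + 1/6 * (4 + sqrt 13) * M ^ 3 * d\<^sup>2"
proof -
  define l where "l = 1/6 * (4 + sqrt (13::real))"
  have l: "l > 0" by (simp add: l_def add_pos_nonneg)
  have "densB e g u d \<le> e * (u \<bullet> u) + e * (l * ((e * d)\<^sup>2 + (g \<bullet> u)\<^sup>2))"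
    using shallow_water_form_upper[of "e * d" "g \<bullet> u"] assms(1)
    unfolding densB_eq l_def by (intro add_left_mono mult_left_mono) auto
  also have "\<dots> \<le> e * (u \<bullet> u) + e * (l * ((e * d)\<^sup>2 + (g \<bullet> g) * (u \<bullet> u)))"
    using Cauchy_Schwarz_ineq[of g u] assms(1) l
    by (intro add_left_mono mult_left_mono) auto
  also have "\<dots> = (e + l * e * (norm g)\<^sup>2) * (u \<bullet> u) + l * e ^ 3 * d\<^sup>2"
    unfolding power2_norm_eq_inner by (simp add: algebra_simps power2_eq_square power3_eq_cube)
  also have "\<dots> \<le> \<sigma> * (u \<bullet> u) + l * M ^ 3 * d\<^sup>2"
    using \<sigma> assms l unfolding l_def[symmetric]
    by (intro add_mono mult_right_mono mult_left_mono power_mono) auto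
  finally show ?thesis by (simp add: l_def)
qed

lemma densB_lower:
  assumes "0 < m" "m \<le> e"
  shows "m * (u \<bullet> u) + 1/6 * (4 - sqrt 13) * m ^ 3 * d\<^sup>2 \<le> densB e g u d"
proof -
  define l where "l = 1/6 * (4 - sqrt (13::real))"
  have l: "l > 0" using sqrt_13_less_4 by (simp add: l_def)
  have "m * (u \<bullet> u) + l * m ^ 3 * d\<^sup>2 \<le> e * (u \<bullet> u) + l * e ^ 3 * d\<^sup>2"
    using assms l by (intro add_mono mult_right_mono mult_left_mono power_mono) auto
  also have "\<dots> = e * (u \<bullet> u) + e * (l * (e * d)\<^sup>2)"
    by (simp add: power2_eq_square power3_eq_cube)
  also have "\<dots> \<le> e * (u \<bullet> u) + e * (l * ((e * d)\<^sup>2 + (g \<bullet> u)\<^sup>2))"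
    using assms l by (intro add_left_mono mult_left_mono) auto
  also have "\<dots> \<le> densB e g u d"
    using shallow_water_form_lower[of "e * d" "g \<bullet> u"] assms
    unfolding densB_eq l_def by (intro add_left_mono mult_left_mono) auto
  finally show ?thesis by (simp add: l_def)
qed

lemma densB_flat_bounds:
  assumes "0 < m" "m \<le> e" "e \<le> M"
  shows "m * (u \<bullet> u) + 1/3 * m ^ 3 * d\<^sup>2 \<le> densB e 0 u d"
    and "densB e 0 u d \<le> M * (u \<bullet> u) + 1/3 * M ^ 3 * d\<^sup>2"
  using assms unfolding densB_def
  by (auto intro!: add_mono mult_right_mono power_mono)


section \<open>Comparison of the forms\<close>

text \<open>A lower bound with coefficients \<open>a\<close>, \<open>b\<close> becomes a bound by \<open>1/\<kappa>\<close> times the integrand of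
  \<open>A[u,u]\<close> as soon as \<open>\<kappa>\<close> dominates both coefficient ratios.\<close>

lemma scaled_le_if_ratios_le:
  fixes \<kappa> \<sigma> \<alpha> a b p q :: real
  assumes "0 < \<kappa>" "\<sigma> \<le> \<kappa> * a" "\<alpha> \<le> \<kappa> * b" "0 \<le> p" "0 \<le> q"
  shows "inverse \<kappa> * (\<sigma> * p + \<alpha> * q) \<le> a * p + b * q"
proof -
  have "\<sigma> * p + \<alpha> * q \<le> \<kappa> * a * p + \<kappa> * b * q"
    using assms by (intro add_mono mult_right_mono) auto
  also have "\<dots> = \<kappa> * (a * p + b * q)"
    by (simp add: algebra_simps)
  finally show ?thesis
    using assms(1) by (simp add: field_simps)
qed

text \<open>
  Integrability of the integrand of \<open>B[u,u]\<close> follows from its domination by that of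
  \<open>A[u,u]\<close>, so that the pointwise bounds may be integrated.
\<close>

lemma form_bounds:
  assumes u: "u \<in> Hdiv_nonzero D"
    and [measurable]: "\<eta> \<in> borel_measurable (dmeasure D)" "gh \<in> borel_measurable (dmeasure D)"
    and pos: "0 < \<sigma>" "0 < \<alpha>" "0 < \<kappa>"
    and lower: "AE x in dmeasure D. \<forall>v d.
      inverse \<kappa> * (\<sigma> * (v \<bullet> v) + \<alpha> * d\<^sup>2) \<le> densB (\<eta> x) (gh x) v d"
    and upper: "AE x in dmeasure D. \<forall>v d.
      densB (\<eta> x) (gh x) v d \<le> \<sigma> * (v \<bullet> v) + \<alpha> * d\<^sup>2"
  shows "0 < formA D \<sigma> \<alpha> u u"
    and "inverse \<kappa> * formA D \<sigma> \<alpha> u u \<le> formB D \<eta> gh u u"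
    and "formB D \<eta> gh u u \<le> formA D \<sigma> \<alpha> u u"
proof -
  let ?M = "dmeasure D" and ?d = "wdiv D u"
  let ?a = "\<lambda>x. \<sigma> * (u x \<bullet> u x) + \<alpha> * (?d x)\<^sup>2"
  let ?b = "\<lambda>x. densB (\<eta> x) (gh x) (u x) (?d x)"
  have [measurable]: "u \<in> borel_measurable ?M" "?d \<in> borel_measurable ?M"
    and intu: "integrable ?M (\<lambda>x. u x \<bullet> u x)"
    and intd: "integrable ?M (\<lambda>x. (?d x)\<^sup>2)"
    and nz: "\<not> (AE x in ?M. u x = 0)"
    using u by (auto simp: Hdiv_nonzero_def Hdiv_def L2_def power2_norm_eq_inner)
  have inta: "integrable ?M ?a"
    using intu intd by simp
  have measb: "?b \<in> borel_measurable ?M"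
    unfolding densB_def by measurable
  have "AE x in ?M. norm (?b x) \<le> norm (?a x)"
    using lower upper
  proof eventually_elim
    case (elim x)
    have "0 \<le> inverse \<kappa> * ?a x"
      using pos by simp
    with elim(1) have "0 \<le> ?b x"
      by (meson order_trans)
    moreover have "?b x \<le> ?a x"
      using elim(2) by blast
    ultimately show ?case by simp
  qed
  then have intb: "integrable ?M ?b"
    by (rule Bochner_Integration.integrable_bound[OF inta measb])
  have A: "formA D \<sigma> \<alpha> u u = integral\<^sup>L ?M ?a"
    by (simp add: formA_def power2_eq_square mult.assoc)
  have B: "formB D \<eta> gh u u = integral\<^sup>L ?M ?b"
    unfolding formB_def densB_def
    by (intro Bochner_Integration.integral_cong refl) (simp add: power2_eq_square algebra_simps)
  show "formB D \<eta> gh u u \<le> formA D \<sigma> \<alpha> u u"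
    unfolding A B using upper by (intro integral_mono_AE intb inta) auto
  have "integral\<^sup>L ?M (\<lambda>x. inverse \<kappa> * ?a x) \<le> integral\<^sup>L ?M ?b"
    using lower by (intro integral_mono_AE integrable_mult_right intb inta) auto
  then show "inverse \<kappa> * formA D \<sigma> \<alpha> u u \<le> formB D \<eta> gh u u"
    unfolding A B by simp
  have "integral\<^sup>L ?M (\<lambda>x. u x \<bullet> u x) \<noteq> 0"
    using nz by (subst integral_nonneg_eq_0_iff_AE[OF intu]) auto
  moreover have "0 \<le> integral\<^sup>L ?M (\<lambda>x. u x \<bullet> u x)"
    by simp
  moreover have "0 \<le> integral\<^sup>L ?M (\<lambda>x. (?d x)\<^sup>2)"
    by simp
  ultimately have "0 < \<sigma> * integral\<^sup>L ?M (\<lambda>x. u x \<bullet> u x) + \<alpha> * integral\<^sup>L ?M (\<lambda>x. (?d x)\<^sup>2)"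
    using pos by (intro add_pos_nonneg mult_pos_pos mult_nonneg_nonneg) linarith+
  also have "\<dots> = integral\<^sup>L ?M ?a"
    using intu intd by simp
  finally show "0 < formA D \<sigma> \<alpha> u u"
    unfolding A .
qed

lemma cond_number_le:
  assumes "0 < \<kappa>"
    and pos: "\<And>u. u \<in> Hdiv_nonzero D \<Longrightarrow> 0 < formA D \<sigma> \<alpha> u u"
    and lower: "\<And>u. u \<in> Hdiv_nonzero D \<Longrightarrow> inverse \<kappa> * formA D \<sigma> \<alpha> u u \<le> formB D \<eta> gh u u"
    and upper: "\<And>u. u \<in> Hdiv_nonzero D \<Longrightarrow> formB D \<eta> gh u u \<le> formA D \<sigma> \<alpha> u u"
  shows "cond_number D \<sigma> \<alpha> \<eta> gh \<le> \<kappa>"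
proof (cases "Hdiv_nonzero D = {}")
  case True
  \<comment> \<open>With no Rayleigh quotients at all, \<open>Inf {} = - Sup {}\<close> in the reals makes the quotient \<open>-1\<close>
    or \<open>0\<close>. Treating this case separately avoids constructing a nonzero field.\<close>
  then have "cond_number D \<sigma> \<alpha> \<eta> gh \<le> 0"
    by (simp add: cond_number_def mu_max_def mu_min_def Inf_real_def)
  then show ?thesis
    using assms(1) by simp
next
  case False
  have "mu_max D \<sigma> \<alpha> \<eta> gh \<le> 1"
    unfolding mu_max_def using False pos upper by (intro cSUP_least) auto
  moreover have "inverse \<kappa> \<le> mu_min D \<sigma> \<alpha> \<eta> gh"
    unfolding mu_min_def using False pos lower by (intro cINF_greatest) (auto simp: pos_le_divide_eq)
  moreover have "0 < inverse \<kappa>"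
    using assms(1) by simp
  ultimately have "mu_max D \<sigma> \<alpha> \<eta> gh / mu_min D \<sigma> \<alpha> \<eta> gh \<le> 1 / inverse \<kappa>"
    by (smt (verit) frac_le divide_right_mono)
  then show ?thesis
    by (simp add: cond_number_def inverse_eq_divide)
qed

lemma gen_eigenvalue_bounds:
  assumes "gen_eigenvalue D \<sigma> \<alpha> \<eta> gh \<nu>"
    and pos: "\<And>u. u \<in> Hdiv_nonzero D \<Longrightarrow> 0 < formA D \<sigma> \<alpha> u u"
    and lower: "\<And>u. u \<in> Hdiv_nonzero D \<Longrightarrow> inverse \<kappa> * formA D \<sigma> \<alpha> u u \<le> formB D \<eta> gh u u"
    and upper: "\<And>u. u \<in> Hdiv_nonzero D \<Longrightarrow> formB D \<eta> gh u u \<le> formA D \<sigma> \<alpha> u u"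
  shows "\<nu> \<in> \<real> \<and> inverse \<kappa> \<le> Re \<nu> \<and> Re \<nu> \<le> 1"
proof -
  obtain u where u: "u \<in> Hdiv_nonzero D"
    and ev: "\<And>v. v \<in> Hdiv D \<Longrightarrow>
      \<nu> * complex_of_real (formA D \<sigma> \<alpha> u v) = complex_of_real (formB D \<eta> gh u v)"
    using assms(1) by (auto simp: gen_eigenvalue_def)
  have "u \<in> Hdiv D"
    using u by (simp add: Hdiv_nonzero_def)
  from ev[OF this] have \<nu>: "\<nu> = complex_of_real (formB D \<eta> gh u u / formA D \<sigma> \<alpha> u u)"
    using pos[OF u] by (simp add: field_simps)
  show ?thesis
    unfolding \<nu> using pos[OF u] lower[OF u] upper[OF u] by (simp add: pos_le_divide_eq)
qed


section \<open>The condition number and the spectrum\<close>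

theorem theorem4p1:
  fixes D :: flow_domain
    and \<eta> h :: "real^2 \<Rightarrow> real"
    and gh :: "real^2 \<Rightarrow> real^2"
    and \<sigma> \<alpha> \<kappa>ub :: real
  assumes "admissible D"
    and "Linf D \<eta>"
    and "is_weak_grad D h gh" and "Linf D gh"
    and "ess_min D \<eta> > 0"
    and "ess_max D (\<lambda>x. norm (gh x)) = 0 \<Longrightarrow>
           \<sigma> = ess_max D \<eta> \<and>
           \<alpha> = 1/3 * ess_max D \<eta> ^ 3 \<and>
           \<kappa>ub = (ess_max D \<eta> / ess_min D \<eta>) ^ 3"
    and "ess_max D (\<lambda>x. norm (gh x)) \<noteq> 0 \<Longrightarrow>
           \<sigma> = ess_max D (\<lambda>x. \<eta> x + 1/6 * (4 + sqrt 13) * \<eta> x * (norm (gh x))\<^sup>2) \<and>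
           \<alpha> = 1/6 * (4 + sqrt 13) * ess_max D \<eta> ^ 3 \<and>
           \<kappa>ub = max (\<sigma> / ess_min D \<eta>)
                    ((4 + sqrt 13) / (4 - sqrt 13) * (ess_max D \<eta> / ess_min D \<eta>) ^ 3)"
  shows "cond_number D \<sigma> \<alpha> \<eta> gh \<le> \<kappa>ub \<and>
         (\<forall>\<nu>. gen_eigenvalue D \<sigma> \<alpha> \<eta> gh \<nu> \<longrightarrow>
            \<nu> \<in> \<real> \<and> inverse \<kappa>ub \<le> Re \<nu> \<and> Re \<nu> \<le> 1)"
proof -
  let ?M = "dmeasure D"
  define m where "m = ess_min D \<eta>"
  define M where "M = ess_max D \<eta>"
  define G where "G = ess_max D (\<lambda>x. norm (gh x))"
  note defs = m_def[symmetric] M_def[symmetric] G_def[symmetric]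
  have m: "0 < m"
    using assms(5) by (simp add: m_def)
  have meas [measurable]: "\<eta> \<in> borel_measurable ?M" "gh \<in> borel_measurable ?M"
    using assms(2,4) by (auto simp: Linf_def)
  have AE_m: "AE x in ?M. m \<le> \<eta> x"
    unfolding m_def by (rule AE_ess_min_le[OF assms(5)])
  have AE_M: "AE x in ?M. \<eta> x \<le> M"
    unfolding M_def
  proof (rule AE_le_ess_max_if_AE_bounded)
    show "AE x in ?M. \<eta> x \<le> ess_max D (\<lambda>x. norm (\<eta> x))"
      using AE_norm_le_ess_max[OF assms(2)] by eventually_elim auto
  qed measurable
  have AE_G: "AE x in ?M. norm (gh x) \<le> G"
    unfolding G_def by (rule AE_norm_le_ess_max[OF assms(4)])
  have nontrivial: "\<not> (AE x in ?M. False)"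
    by (rule not_AE_False_if_ess_min_pos[OF assms(5)])
  have mM: "m \<le> M"
  proof (rule ccontr)
    assume "\<not> m \<le> M"
    from AE_m AE_M have "AE x in ?M. False"
      by eventually_elim (use \<open>\<not> m \<le> M\<close> in simp)
    with nontrivial show False by contradiction
  qed
  have pointwise: "0 < \<sigma> \<and> 0 < \<alpha> \<and> 0 < \<kappa>ub \<and>
    (AE x in ?M. \<forall>v d. inverse \<kappa>ub * (\<sigma> * (v \<bullet> v) + \<alpha> * d\<^sup>2) \<le> densB (\<eta> x) (gh x) v d) \<and>
    (AE x in ?M. \<forall>v d. densB (\<eta> x) (gh x) v d \<le> \<sigma> * (v \<bullet> v) + \<alpha> * d\<^sup>2)"
  proof (cases "G = 0")
    case True
    then have \<sigma>: "\<sigma> = M" and \<alpha>: "\<alpha> = 1/3 * M ^ 3" and \<kappa>: "\<kappa>ub = (M / m) ^ 3"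
      using assms(6) by (simp_all add: defs)
    have pos: "0 < \<kappa>ub"
      using m mM by (simp add: \<kappa>)
    have "\<sigma> \<le> \<kappa>ub * m"
    proof -
      \<comment> \<open>As \<open>M / m \<ge> 1\<close>, the cube that the divergence term requires also covers this ratio.\<close>
      have "(M / m) ^ 1 \<le> (M / m) ^ 3"
        using m mM by (intro power_increasing) auto
      then show ?thesis
        using m by (simp add: \<sigma> \<kappa> pos_divide_le_eq)
    qed
    moreover have "\<alpha> \<le> \<kappa>ub * (1/3 * m ^ 3)"
      using m by (simp add: \<alpha> \<kappa> power_divide)
    ultimately have scale: "inverse \<kappa>ub * (\<sigma> * p + \<alpha> * q) \<le> m * p + 1/3 * m ^ 3 * q"
      if "0 \<le> p" "0 \<le> q" for p q
      using that pos by (intro scaled_le_if_ratios_le)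
    have "AE x in ?M. \<forall>v d. inverse \<kappa>ub * (\<sigma> * (v \<bullet> v) + \<alpha> * d\<^sup>2) \<le> densB (\<eta> x) (gh x) v d"
      using AE_m AE_M AE_G
    proof eventually_elim
      case (elim x)
      then have "gh x = 0"
        using True by simp
      then show ?case
        by (auto intro!: order_trans[OF scale densB_flat_bounds(1)[OF m elim(1,2)]])
    qed
    moreover have "AE x in ?M. \<forall>v d. densB (\<eta> x) (gh x) v d \<le> \<sigma> * (v \<bullet> v) + \<alpha> * d\<^sup>2"
      using AE_m AE_M AE_G
    proof eventually_elim
      case (elim x)
      then have "gh x = 0"
        using True by simp
      then show ?case
        unfolding \<sigma> \<alpha> using densB_flat_bounds(2)[OF m elim(1,2)] by auto
    qed
    ultimately show ?thesis
      using pos m mM by (simp add: \<sigma> \<alpha>)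
  next
    case False
    let ?s = "\<lambda>x. \<eta> x + 1/6 * (4 + sqrt 13) * \<eta> x * (norm (gh x))\<^sup>2"
    have \<sigma>: "\<sigma> = ess_max D ?s" and \<alpha>: "\<alpha> = 1/6 * (4 + sqrt 13) * M ^ 3"
      and \<kappa>: "\<kappa>ub = max (\<sigma> / m) ((4 + sqrt 13) / (4 - sqrt 13) * (M / m) ^ 3)"
      using assms(7) False by (simp_all add: defs)
    have AE_\<sigma>: "AE x in ?M. ?s x \<le> \<sigma>"
      unfolding \<sigma>
    proof (rule AE_le_ess_max_if_AE_bounded)
      show "AE x in ?M. ?s x \<le> M + 1/6 * (4 + sqrt 13) * M * G\<^sup>2"
        using AE_m AE_M AE_G
      proof eventually_elim
        case (elim x)
        then show ?case
          using m by (intro add_mono mult_mono power_mono) auto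
      qed
    qed measurable
    have "m \<le> \<sigma>"
    proof (rule ccontr)
      assume neg: "\<not> m \<le> \<sigma>"
      from AE_m AE_\<sigma> have "AE x in ?M. False"
      proof eventually_elim
        case (elim x)
        have "0 \<le> 1/6 * (4 + sqrt 13) * \<eta> x * (norm (gh x))\<^sup>2"
          using elim m by (intro mult_nonneg_nonneg) auto
        with elim neg show ?case by linarith
      qed
      with nontrivial show False by contradiction
    qed
    with m have \<sigma>_pos: "0 < \<sigma>" by linarith
    have pos: "0 < \<kappa>ub"
      using m \<sigma>_pos by (simp add: \<kappa> less_max_iff_disj)
    have "\<sigma> / m \<le> \<kappa>ub"
      by (simp add: \<kappa>)
    then have "\<sigma> \<le> \<kappa>ub * m"
      using m by (simp add: pos_divide_le_eq)
    moreover have "\<alpha> \<le> \<kappa>ub * (1/6 * (4 - sqrt 13) * m ^ 3)"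
    proof -
      have "\<alpha> = (4 + sqrt 13) / (4 - sqrt 13) * (M / m) ^ 3 * (1/6 * (4 - sqrt 13) * m ^ 3)"
        using m sqrt_13_less_4 by (simp add: \<alpha> power_divide)
      also have "\<dots> \<le> \<kappa>ub * (1/6 * (4 - sqrt 13) * m ^ 3)"
        using m sqrt_13_less_4 by (intro mult_right_mono) (auto simp: \<kappa>)
      finally show ?thesis .
    qed
    ultimately have scale:
      "inverse \<kappa>ub * (\<sigma> * p + \<alpha> * q) \<le> m * p + 1/6 * (4 - sqrt 13) * m ^ 3 * q"
      if "0 \<le> p" "0 \<le> q" for p q
      using that pos by (intro scaled_le_if_ratios_le)
    have "AE x in ?M. \<forall>v d. inverse \<kappa>ub * (\<sigma> * (v \<bullet> v) + \<alpha> * d\<^sup>2) \<le> densB (\<eta> x) (gh x) v d"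
      using AE_m
    proof eventually_elim
      case (elim x)
      show ?case
        by (intro allI order_trans[OF scale densB_lower[OF m elim]]) auto
    qed
    moreover have "AE x in ?M. \<forall>v d. densB (\<eta> x) (gh x) v d \<le> \<sigma> * (v \<bullet> v) + \<alpha> * d\<^sup>2"
      using AE_m AE_M AE_\<sigma>
    proof eventually_elim
      case (elim x)
      then show ?case
        unfolding \<alpha> using m by (intro allI densB_upper) auto
    qed
    moreover have "0 < \<alpha>"
      using m mM by (simp add: \<alpha> add_pos_nonneg)
    ultimately show ?thesis
      using pos \<sigma>_pos by blast
  qed
  from pointwise have \<kappa>_pos: "0 < \<kappa>ub"
    by blast
  have bounds: "0 < formA D \<sigma> \<alpha> u u"
      "inverse \<kappa>ub * formA D \<sigma> \<alpha> u u \<le> formB D \<eta> gh u u"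
      "formB D \<eta> gh u u \<le> formA D \<sigma> \<alpha> u u" if "u \<in> Hdiv_nonzero D" for u
    using form_bounds[OF that meas, of \<sigma> \<alpha> \<kappa>ub] pointwise by blast+
  have "cond_number D \<sigma> \<alpha> \<eta> gh \<le> \<kappa>ub"
    using \<kappa>_pos bounds by (rule cond_number_le)
  moreover have "\<nu> \<in> \<real> \<and> inverse \<kappa>ub \<le> Re \<nu> \<and> Re \<nu> \<le> 1"
    if "gen_eigenvalue D \<sigma> \<alpha> \<eta> gh \<nu>" for \<nu>
    using that bounds by (rule gen_eigenvalue_bounds)
  ultimately show ?thesis
    by blast
qed

end
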